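(* For any $n\in\mathbb{N}$, a set $A\subseteq\mathbb{N}$ (of upper fractional density $\alpha>0$) contains an arithmetic progression of length $n$ if and only if the set $B(A)\subset[0,1]$ obtained from $A$ by the construction described in the context contains an arithmetic progression of length $n$.
   Context: $\mathbb{N}$ contains $0$ as far as subsets $A$ are concerned, and $[0,N)$ denotes $\{0,1,\ldots,N-1\}$ when intersected with subsets of $\mathbb{N}$. Arithmetic progressions are non-trivial, i.e. have non-zero common difference; those in $A$ are progressions of integers and those in $B(A)$ are progressions of real numbers. Upper fractional density: $A\subseteq\mathbb{N}$ has upper fractional density $\alpha$ if $\limsup_{N\to\infty}|A\cap[0,N)|/N^{\gamma}$ is $\infty$ for every $\gamma<\alpha$ and $0$ for every $\gamma>\alpha$. Construction of $B=B(A)$: let $A\subseteq\mathbb{N}$ have upper fractional density $\alpha>0$. Let $(\alpha_i)_{i\ge1}$ be a real sequence strictly increasing to $\alpha$, and let $(\gamma_i)_{i\ge1}$ be an increasing sequence of positive reals tending to infinity. Let $(N_i)_{i\ge1}$ be a strictly increasing sequence of positive integers such that $c_i:=|A\cap[0,N_i)|/N_i^{\alpha_i}>\gamma_i$ for every $i$ (such a sequence exists by the definition of upper fractional density). Put $\zeta_i=1/(2N_i)$ and $A_i=A\cap[0,N_i)$. For $k\ge1$ let $$B_k=\bigcup_{(j_1,\ldots,j_k)\in A_1\times\cdots\times A_k}\bigl[x,\,x+\zeta_1\cdots\zeta_k\bigr),\qquad x=\frac{j_1}{N_1}+\frac{\zeta_1 j_2}{N_2}+\cdots+\frac{\zeta_1\cdots\zeta_{k-1}j_k}{N_k}.$$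 (That is, each interval of $B_{k}$ is divided into $N_{k+1}$ equal intervals, and the initial half of the $i$-th of these, $i=0,\ldots,N_{k+1}-1$, is kept exactly when $i\in A_{k+1}$.) Finally $B(A)=\bigcap_{k\ge1}B_k$. The set $B(A)$ depends on the choices of $(\alpha_i),(\gamma_i),(N_i)$, which are regarded as fixed. *)

theory Defs
  imports Complex_Main "HOL-Library.Extended_Real" "HOL-Library.Liminf_Limsup" "HOL-Library.FuncSet"
begin

(* The junk value of the quotient at N = 0 does not affect the limsup. *)
definition has_upper_fractional_density :: "nat set \<Rightarrow> real \<Rightarrow> bool" where
  "has_upper_fractional_density A \<alpha> \<longleftrightarrow>
     (\<forall>\<gamma><\<alpha>. limsup (\<lambda>N. ereal (real (card (A \<inter> {0..<N})) / real N powr \<gamma>)) = \<infinity>) \<and>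
     (\<forall>\<gamma>>\<alpha>. limsup (\<lambda>N. ereal (real (card (A \<inter> {0..<N})) / real N powr \<gamma>)) = 0)"

definition contains_AP :: "'a::ring_1 set \<Rightarrow> nat \<Rightarrow> bool" where
  "contains_AP S n \<longleftrightarrow> (\<exists>a d. d \<noteq> 0 \<and> (\<forall>i<n. a + of_nat i * d \<in> S))"

(* All sequences below are indexed from 1; their value at 0 is never used. *)
definition zeta :: "(nat \<Rightarrow> nat) \<Rightarrow> nat \<Rightarrow> real" where
  "zeta N i = 1 / (2 * real (N i))"

definition left_endpoint :: "(nat \<Rightarrow> nat) \<Rightarrow> nat \<Rightarrow> (nat \<Rightarrow> nat) \<Rightarrow> real" where
  "left_endpoint N k j = (\<Sum>m=1..k. (\<Prod>i=1..<m. zeta N i) * real (j m) / real (N m))"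

definition B_level :: "nat set \<Rightarrow> (nat \<Rightarrow> nat) \<Rightarrow> nat \<Rightarrow> real set" where
  "B_level A N k =
     (\<Union>j \<in> PiE {1..k} (\<lambda>i. A \<inter> {0..<N i}).
        {left_endpoint N k j ..< left_endpoint N k j + (\<Prod>i=1..k. zeta N i)})"

(* The sequences alpha_i and gamma_i only constrain the choice of N_i, so the set itself
   is determined by A and N. *)
definition B_set :: "nat set \<Rightarrow> (nat \<Rightarrow> nat) \<Rightarrow> real set" where
  "B_set A N = (\<Inter>k\<in>{1..}. B_level A N k)"

end

theory Submission
  imports Defs
begin

text \<open>
  A point of \<open>B_set A N\<close> is a real number in \<open>[0,1)\<close> whose generalised digits \<open>j 1, j 2, \<dots>\<close> satisfy
  \<open>j i \<in> A\<close> and \<open>j i < N i\<close>; the factors one half in \<open>zeta\<close> leave a gap after every digit cell. After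
  rescaling a cell of level \<open>k\<close> to \<open>[0, N (Suc k))\<close>, a point with next digit \<open>j\<close> sits in
  \<open>[j, j + 1/2)\<close>.

  From \<open>A\<close> to \<open>B_set A N\<close>: a progression in \<open>A\<close> lies below some \<open>N k\<close>. Fixing all digits except the
  \<open>k\<close>-th one and letting the \<open>k\<close>-th one run through the progression yields points of \<open>B_set A N\<close>
  that depend affinely on that digit, hence a progression (lemma \<open>AP_in_B_set\<close>).

  From \<open>B_set A N\<close> to \<open>A\<close>: because the cells shrink to points, a progression with at least two terms
  is separated at some first level, so its terms share all earlier digits but not the next one.
  After rescaling, the terms form a real progression all of whose fractional parts are below one
  half. Consecutive integer parts then differ by an integer within distance strictly less than
  one half of the common difference. There is only one such integer, so the integer parts, which
  are the digits and lie in \<open>A\<close>, form a progression too (lemma \<open>AP_of_integer_parts\<close>), and it is not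
  constant because the digits differ.
\<close>

section \<open>Cells and their digits\<close>

definition cell_width :: "(nat \<Rightarrow> nat) \<Rightarrow> nat \<Rightarrow> real" where
  "cell_width N k = (\<Prod>i=1..k. zeta N i)"

definition cell :: "(nat \<Rightarrow> nat) \<Rightarrow> nat \<Rightarrow> (nat \<Rightarrow> nat) \<Rightarrow> real set" where
  "cell N k j = {left_endpoint N k j ..< left_endpoint N k j + cell_width N k}"

lemma mem_B_level_iff:
  "x \<in> B_level A N k \<longleftrightarrow> (\<exists>j \<in> PiE {1..k} (\<lambda>i. A \<inter> {0..<N i}). x \<in> cell N k j)"
  by (auto simp: B_level_def cell_def cell_width_def)

lemma cell_width_0 [simp]: "cell_width N 0 = 1"
  by (simp add: cell_width_def)

lemma cell_width_Suc: "cell_width N (Suc k) = cell_width N k / (2 * real (N (Suc k)))"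
  by (simp add: cell_width_def zeta_def)

lemma left_endpoint_0 [simp]: "left_endpoint N 0 j = 0"
  by (simp add: left_endpoint_def)

lemma left_endpoint_Suc:
  "left_endpoint N (Suc k) j = left_endpoint N k j + cell_width N k * real (j (Suc k)) / real (N (Suc k))"
  by (simp add: left_endpoint_def cell_width_def atLeastLessThanSuc_atLeastAtMost)

lemma left_endpoint_cong:
  assumes "\<And>i. i \<in> {1..k} \<Longrightarrow> j i = j' i"
  shows "left_endpoint N k j = left_endpoint N k j'"
  unfolding left_endpoint_def using assms by (intro sum.cong) auto

lemma cell_cong:
  assumes "\<And>i. i \<in> {1..k} \<Longrightarrow> j i = j' i"
  shows "cell N k j = cell N k j'"
  using left_endpoint_cong[OF assms] by (simp add: cell_def)

lemma left_endpoint_fun_upd: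
  assumes "1 \<le> m" "m \<le> k"
  shows "left_endpoint N k (j(m := a)) =
    left_endpoint N k j + cell_width N (m - 1) / real (N m) * (real a - real (j m))"
  using assms(2)
proof (induction k rule: dec_induct)
  case base
  obtain m' where m: "m = Suc m'"
    using assms(1) by (cases m) auto
  have "left_endpoint N m' (j(m := a)) = left_endpoint N m' j"
    by (rule left_endpoint_cong) (auto simp: m)
  then have "left_endpoint N m (j(m := a)) = left_endpoint N m' j + cell_width N m' * real a / real (N m)"
    unfolding m left_endpoint_Suc by (simp only: fun_upd_same)
  also have "\<dots> = left_endpoint N m j + cell_width N (m - 1) / real (N m) * (real a - real (j m))"
    unfolding m left_endpoint_Suc diff_Suc_1 by argo
  finally show ?case .
next
  case (step k)
  then show ?case
    by (simp add: left_endpoint_Suc)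
qed

text \<open>Since \<open>zeta N k\<close> is one half of \<open>1 / N k\<close>, the rescaled cell of the digit \<open>d\<close> is \<open>[d, d + 1/2)\<close>
  and not \<open>[d, d + 1)\<close>; this is what makes digits of a progression form a progression.\<close>

lemma mem_cell_Suc_iff:
  fixes j :: "nat \<Rightarrow> nat"
  assumes "cell_width N k > 0" "N (Suc k) > 0"
  defines "u \<equiv> \<lambda>x. (x - left_endpoint N k j) * real (N (Suc k)) / cell_width N k"
  shows "x \<in> cell N (Suc k) j \<longleftrightarrow> real (j (Suc k)) \<le> u x \<and> u x < real (j (Suc k)) + 1/2"
  using assms(1,2) by (auto simp: cell_def u_def left_endpoint_Suc cell_width_Suc field_simps)

context
  fixes N :: "nat \<Rightarrow> nat"
  assumes N_pos: "\<And>i. i \<ge> 1 \<Longrightarrow> N i > 0"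
begin

lemma cell_width_pos: "cell_width N k > 0"
  by (induction k) (auto simp: cell_width_Suc N_pos)

lemma cell_width_le: "cell_width N k \<le> (1/2) ^ k"
proof (induction k)
  case (Suc k)
  have "real (N (Suc k)) \<ge> 1"
    using N_pos[of "Suc k"] by simp
  then have "cell_width N (Suc k) \<le> cell_width N k / 2"
    unfolding cell_width_Suc using cell_width_pos[of k] by (intro divide_left_mono) auto
  then show ?case
    using Suc.IH by simp
qed simp

text \<open>The reserve of one further cell width on the right is what keeps the limit of the left
  endpoints inside every half-open cell.\<close>

lemma right_endpoint_Suc_le:
  assumes "j (Suc k) < N (Suc k)"
  shows "left_endpoint N (Suc k) j + 2 * cell_width N (Suc k) \<le> left_endpoint N k j + cell_width N k"
proof -
  have pos: "real (N (Suc k)) > 0"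
    using N_pos by simp
  have "cell_width N k * (real (j (Suc k)) + 1) \<le> cell_width N k * real (N (Suc k))"
    using assms cell_width_pos[of k] by (intro mult_left_mono) auto
  then have "cell_width N k * (real (j (Suc k)) + 1) / real (N (Suc k)) \<le> cell_width N k"
    using pos by (simp add: field_simps)
  then show ?thesis
    by (simp add: left_endpoint_Suc cell_width_Suc distrib_left add_divide_distrib)
qed

lemma left_endpoint_le_Suc: "left_endpoint N k j \<le> left_endpoint N (Suc k) j"
  using cell_width_pos[of k] by (simp add: left_endpoint_Suc)

lemma cell_Suc_subset:
  assumes "j (Suc k) < N (Suc k)"
  shows "cell N (Suc k) j \<subseteq> cell N k j"
  using right_endpoint_Suc_le[of j k, OF assms] left_endpoint_le_Suc[of k j] cell_width_pos[of "Suc k"]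
  by (auto simp: cell_def)

lemma cell_subset_unit:
  assumes "\<And>i. i \<in> {1..k} \<Longrightarrow> j i < N i"
  shows "cell N k j \<subseteq> {0..<1}"
  using assms
proof (induction k)
  case (Suc k)
  have "cell N (Suc k) j \<subseteq> cell N k j"
    by (rule cell_Suc_subset) (simp add: Suc.prems)
  with Suc show ?case by auto
qed (simp add: cell_def)

lemma cell_digits_unique:
  assumes "x \<in> cell N k j" "x \<in> cell N k j'"
    and "\<And>i. i \<in> {1..k} \<Longrightarrow> j i < N i" "\<And>i. i \<in> {1..k} \<Longrightarrow> j' i < N i"
    and "i \<in> {1..k}"
  shows "j i = j' i"
  using assms
proof (induction k arbitrary: i)
  case (Suc k)
  have "x \<in> cell N k j" "x \<in> cell N k j'"
    using Suc.prems cell_Suc_subset[of j k] cell_Suc_subset[of j' k] by auto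
  then have agree: "j i = j' i" if "i \<in> {1..k}" for i
    using Suc.IH[of i] Suc.prems that by simp
  have "left_endpoint N k j' = left_endpoint N k j"
    using agree by (intro left_endpoint_cong) auto
  then have "j (Suc k) = j' (Suc k)"
    using Suc.prems(1,2) mem_cell_Suc_iff[of N k x j] mem_cell_Suc_iff[of N k x j']
      cell_width_pos[of k] N_pos[of "Suc k"]
    by simp
  with agree Suc.prems(5) show ?case
    by (cases "i = Suc k") auto
qed simp

section \<open>Points with prescribed digits\<close>

lemma left_endpoint_convergent:
  assumes j: "\<And>i. i \<ge> 1 \<Longrightarrow> j i < N i"
  obtains x where "(\<lambda>k. left_endpoint N k j) \<longlonglongrightarrow> x"
proof -
  have "left_endpoint N k j \<in> {0..<1}" for k
    using cell_subset_unit[of k j] j cell_width_pos[of k] by (auto simp: cell_def)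
  moreover have "incseq (\<lambda>k. left_endpoint N k j)"
    by (intro incseq_SucI left_endpoint_le_Suc)
  ultimately show ?thesis
    using that incseq_convergent[of "\<lambda>k. left_endpoint N k j" 1]
    by (meson atLeastLessThan_iff less_imp_le)
qed

lemma limit_in_cell:
  assumes j: "\<And>i. i \<ge> 1 \<Longrightarrow> j i < N i"
    and lim: "(\<lambda>k. left_endpoint N k j) \<longlonglongrightarrow> x"
  shows "x \<in> cell N k j"
proof -
  have inc: "incseq (\<lambda>k. left_endpoint N k j)"
    by (intro incseq_SucI left_endpoint_le_Suc)
  have dec: "decseq (\<lambda>k. left_endpoint N k j + cell_width N k)"
  proof (rule decseq_SucI)
    show "left_endpoint N (Suc m) j + cell_width N (Suc m) \<le> left_endpoint N m j + cell_width N m" for m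
      using right_endpoint_Suc_le[of j m] j cell_width_pos[of "Suc m"] by simp
  qed
  have "left_endpoint N k j \<le> x"
    using incseq_le[OF inc lim] .
  moreover have "x \<le> left_endpoint N (Suc k) j + cell_width N (Suc k)"
  proof (rule LIMSEQ_le_const2[OF lim], intro exI allI impI)
    fix m assume "Suc k \<le> m"
    then show "left_endpoint N m j \<le> left_endpoint N (Suc k) j + cell_width N (Suc k)"
      using decseqD[OF dec, of "Suc k" m] cell_width_pos[of m] by simp
  qed
  \<comment> \<open>the closed bound at level \<open>Suc k\<close> gives the strict one at level \<open>k\<close>\<close>
  ultimately show ?thesis
    using right_endpoint_Suc_le[of j k] j cell_width_pos[of "Suc k"] by (simp add: cell_def)
qed

lemma limit_in_B_set:
  assumes j: "\<And>i. i \<ge> 1 \<Longrightarrow> j i \<in> A \<inter> {0..<N i}"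
    and lim: "(\<lambda>k. left_endpoint N k j) \<longlonglongrightarrow> x"
  shows "x \<in> B_set A N"
  unfolding B_set_def
proof
  fix k :: nat
  have "x \<in> cell N k (restrict j {1..k})"
    using limit_in_cell[OF _ lim, of k] j by (subst cell_cong[of k _ j]) auto
  moreover have "restrict j {1..k} \<in> PiE {1..k} (\<lambda>i. A \<inter> {0..<N i})"
    using j by auto
  ultimately show "x \<in> B_level A N k"
    unfolding mem_B_level_iff by blast
qed

lemma AP_in_B_set:
  assumes ne: "\<And>i. i \<ge> 1 \<Longrightarrow> A \<inter> {0..<N i} \<noteq> {}"
    and unbounded: "\<And>b. \<exists>m\<ge>1. b \<le> N m"
    and AP: "contains_AP (int ` A) n"
  shows "contains_AP (B_set A N) n"
proof -
  obtain a d where d: "d \<noteq> 0" and "\<forall>l<n. a + int l * d \<in> int ` A"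
    using AP unfolding contains_AP_def by auto
  then obtain t where t: "t l \<in> A" "int (t l) = a + int l * d" if "l < n" for l
    unfolding image_iff by metis
  obtain m where m: "m \<ge> 1" "Suc (\<Sum>l<n. t l) \<le> N m"
    using unbounded by blast
  have t_less: "t l < N m" if "l < n" for l
    using m(2) member_le_sum[of l "{..<n}" t] that by simp
  define j where "j i = (SOME c. c \<in> A \<inter> {0..<N i})" for i
  have j: "j i \<in> A \<inter> {0..<N i}" if "i \<ge> 1" for i
    unfolding j_def using ne[OF that] by (rule some_in_eq[THEN iffD2])
  have "\<And>i. i \<ge> 1 \<Longrightarrow> j i < N i"
    using j by auto
  then obtain x where x: "(\<lambda>k. left_endpoint N k j) \<longlonglongrightarrow> x"
    using left_endpoint_convergent by blast
  define s where "s = cell_width N (m - 1) / real (N m)"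
  have "s \<noteq> 0"
    using cell_width_pos[of "m - 1"] N_pos[OF m(1)] by (simp add: s_def)
  have "(x + s * (of_int a - real (j m))) + real l * (s * of_int d) \<in> B_set A N" if l: "l < n" for l
  proof (rule limit_in_B_set)
    show "(j(m := t l)) i \<in> A \<inter> {0..<N i}" if "i \<ge> 1" for i
      using j[OF that] t(1)[OF l] t_less[OF l] by auto
    have tl: "real (t l) = of_int a + real l * of_int d"
      using arg_cong[OF t(2)[OF l], of "of_int :: int \<Rightarrow> real"] by simp
    have "\<forall>\<^sub>F k in sequentially.
        left_endpoint N k j + s * (real (t l) - real (j m)) = left_endpoint N k (j(m := t l))"
      using eventually_ge_at_top[of m] by eventually_elim (simp only: left_endpoint_fun_upd[OF m(1)] s_def)
    then have "(\<lambda>k. left_endpoint N k (j(m := t l))) \<longlonglongrightarrow> x + s * (real (t l) - real (j m))"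
      by (rule Lim_transform_eventually[rotated]) (intro tendsto_intros x)
    also have "x + s * (real (t l) - real (j m)) =
        (x + s * (of_int a - real (j m))) + real l * (s * of_int d)"
      by (simp add: tl algebra_simps)
    finally show "(\<lambda>k. left_endpoint N k (j(m := t l))) \<longlonglongrightarrow>
        (x + s * (of_int a - real (j m))) + real l * (s * of_int d)" .
  qed
  moreover have "s * of_int d \<noteq> 0"
    using \<open>s \<noteq> 0\<close> d by simp
  ultimately show ?thesis
    unfolding contains_AP_def by blast
qed

lemma B_set_subset_unit: "B_set A N \<subseteq> {0..<1}"
proof
  fix x assume "x \<in> B_set A N"
  then have "x \<in> B_level A N 1"
    by (simp add: B_set_def)
  then obtain j where "j \<in> PiE {1..1} (\<lambda>i. A \<inter> {0..<N i})" "x \<in> cell N 1 j"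
    unfolding mem_B_level_iff by blast
  then show "x \<in> {0..<1}"
    using cell_subset_unit[of 1 j] by (auto simp: PiE_iff)
qed

end

section \<open>Rounding a progression\<close>

text \<open>Consecutive differences of the \<open>j l\<close> are integers in the open interval of length one around
  the real common difference, and such an interval holds only one integer.\<close>

lemma AP_of_integer_parts:
  fixes u :: "nat \<Rightarrow> real" and j :: "nat \<Rightarrow> int"
  assumes u: "\<And>l. l < n \<Longrightarrow> u l = c + real l * \<delta>"
    and j: "\<And>l. l < n \<Longrightarrow> of_int (j l) \<le> u l" "\<And>l. l < n \<Longrightarrow> u l < of_int (j l) + 1/2"
    and "l < n"
  shows "j l = j 0 + int l * (j 1 - j 0)"
  using \<open>l < n\<close>
proof (induction l)
  case (Suc l)
  have "u (Suc l) - u l = \<delta>" "u 1 - u 0 = \<delta>"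
    using u[of l] u[of "Suc l"] u[of 0] u[of 1] Suc.prems by (simp_all add: algebra_simps)
  then have "j (Suc l) - j l = j 1 - j 0"
    using j[of l] j[of "Suc l"] j[of 0] j[of 1] Suc.prems by linarith
  then show ?case
    using Suc by (simp add: algebra_simps)
qed simp

lemma AP_of_AP_in_B_set:
  assumes N_pos: "\<And>i. i \<ge> 1 \<Longrightarrow> N i > 0"
    and n: "n \<ge> 2"
    and AP: "contains_AP (B_set A N) n"
  shows "contains_AP (int ` A) n"
proof (rule ccontr)
  assume no_AP: "\<not> contains_AP (int ` A) n"
  obtain a d where d: "d \<noteq> 0" and "\<forall>l<n. a + real l * d \<in> B_set A N"
    using AP unfolding contains_AP_def by auto
  define x where "x l = a + real l * d" for l
  have x: "x l \<in> B_set A N" if "l < n" for l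
    using that \<open>\<forall>l<n. _\<close> by (simp add: x_def)
  \<comment> \<open>Without a progression in \<open>A\<close>, the terms are never separated.\<close>
  have same_cell: "\<exists>j. (\<forall>i\<in>{1..k}. j i < N i) \<and> (\<forall>l<n. x l \<in> cell N k j)" for k
  proof (induction k)
    case 0
    have "x l \<in> cell N 0 (\<lambda>_. 0)" if "l < n" for l
      using subsetD[OF B_set_subset_unit[of N A, OF N_pos] x[OF that]] by (simp add: cell_def)
    then show ?case
      by auto
  next
    case (Suc k)
    then obtain j where j: "\<forall>i\<in>{1..k}. j i < N i" "\<forall>l<n. x l \<in> cell N k j"
      by blast
    have "\<exists>J \<in> PiE {1..Suc k} (\<lambda>i. A \<inter> {0..<N i}). x l \<in> cell N (Suc k) J" if "l < n" for l
      using x[OF that] unfolding mem_B_level_iff[symmetric] by (simp add: B_set_def)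
    then obtain J where J: "J l \<in> PiE {1..Suc k} (\<lambda>i. A \<inter> {0..<N i})" "x l \<in> cell N (Suc k) (J l)"
      if "l < n" for l
      by metis
    have J_mem: "J l i \<in> A" "J l i < N i" if "l < n" "i \<in> {1..Suc k}" for l i
      using PiE_mem[OF J(1) that(2)] that(1) by auto
    have agree: "J l i = j i" if l: "l < n" and i: "i \<in> {1..k}" for l i
    proof (rule cell_digits_unique[of N "x l" k, OF N_pos _ _ _ _ i])
      show "x l \<in> cell N k (J l)"
        using cell_Suc_subset[of N "J l" k, OF N_pos] J_mem[OF l] J(2)[OF l] by auto
    qed (use j J_mem[OF l] l in auto)
    have left: "left_endpoint N k (J l) = left_endpoint N k j" if "l < n" for l
      using agree that by (intro left_endpoint_cong) auto
    define s where "s = real (N (Suc k)) / cell_width N k"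
    define u where "u l = (x l - left_endpoint N k j) * s" for l
    have digit: "real (J l (Suc k)) \<le> u l" "u l < real (J l (Suc k)) + 1/2" if "l < n" for l
      using J(2)[OF that] mem_cell_Suc_iff[of N k "x l" "J l"] left[OF that]
        cell_width_pos[of N k, OF N_pos] N_pos[of "Suc k"]
      by (simp_all add: u_def s_def)
    define D where "D = int (J 1 (Suc k)) - int (J 0 (Suc k))"
    have prog: "int (J l (Suc k)) = int (J 0 (Suc k)) + int l * D" if "l < n" for l
      unfolding D_def
    proof (rule AP_of_integer_parts[of n u "(a - left_endpoint N k j) * s" "d * s"])
      show "u l = (a - left_endpoint N k j) * s + real l * (d * s)" for l
        by (simp add: u_def x_def algebra_simps)
    qed (use digit that in simp_all)
    have "int (J 0 (Suc k)) + int l * D \<in> int ` A" if "l < n" for l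
      unfolding prog[OF that, symmetric] using J_mem(1)[OF that, of "Suc k"] by simp
    then have "D = 0"
      using no_AP unfolding contains_AP_def of_nat_id by blast
    have "J l i = J 0 i" if l: "l < n" and i: "i \<in> {1..Suc k}" for l i
    proof (cases "i = Suc k")
      case True
      then show ?thesis
        using prog[OF l] \<open>D = 0\<close> by simp
    next
      case False
      then have "i \<in> {1..k}"
        using i by simp
      then show ?thesis
        using agree[of l i] agree[of 0 i] l n by simp
    qed
    then have "cell N (Suc k) (J l) = cell N (Suc k) (J 0)" if "l < n" for l
      using that by (intro cell_cong)
    then have "\<forall>l<n. x l \<in> cell N (Suc k) (J 0)"
      using J(2) by blast
    moreover have "\<forall>i\<in>{1..Suc k}. J 0 i < N i"
      using J_mem(2)[of 0] n by auto
    ultimately show ?case by blast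
  qed
  have "\<bar>d\<bar> \<le> (1/2) ^ k" for k
  proof -
    obtain j where j: "\<And>l. l < n \<Longrightarrow> x l \<in> cell N k j"
      using same_cell[of k] by blast
    have "x 0 \<in> cell N k j" "x 1 \<in> cell N k j"
      using n by (auto intro!: j)
    then have "\<bar>d\<bar> \<le> cell_width N k"
      by (auto simp: cell_def x_def)
    also have "\<dots> \<le> (1/2) ^ k"
      by (rule cell_width_le[of N, OF N_pos])
    finally show ?thesis .
  qed
  moreover obtain k where "(1/2 :: real) ^ k < \<bar>d\<bar>"
    using real_arch_pow_inv[of "\<bar>d\<bar>" "1/2"] d by auto
  ultimately show False
    by (meson not_le)
qed

section \<open>The equivalence\<close>

theorem proposition1p4:
  fixes A :: "nat set" and \<alpha> :: real
    and \<alpha>s \<gamma>s :: "nat \<Rightarrow> real" and N :: "nat \<Rightarrow> nat" and n :: nat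
  assumes "has_upper_fractional_density A \<alpha>" and "\<alpha> > 0"
    and "strict_mono_on {1..} \<alpha>s" and "\<alpha>s \<longlonglongrightarrow> \<alpha>"
    and "mono_on {1..} \<gamma>s" and "\<And>i. i \<ge> 1 \<Longrightarrow> \<gamma>s i > 0"
    and "filterlim \<gamma>s at_top sequentially"
    and "strict_mono_on {1..} N" and "\<And>i. i \<ge> 1 \<Longrightarrow> N i > 0"
    and "\<And>i. i \<ge> 1 \<Longrightarrow> real (card (A \<inter> {0..<N i})) / real (N i) powr \<alpha>s i > \<gamma>s i"
  shows "B_set A N \<subseteq> {0..1} \<and>
         (contains_AP (int ` A) n \<longleftrightarrow> contains_AP (B_set A N) n)"
proof (intro conjI iffI)
  have N_pos: "\<And>i. i \<ge> 1 \<Longrightarrow> N i > 0"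
    by fact
  have ne: "A \<inter> {0..<N i} \<noteq> {}" if "i \<ge> 1" for i
    using assms(6)[OF that] assms(10)[OF that] by auto
  have "b \<le> N (Suc b)" for b
  proof (induction b)
    case (Suc b)
    have "N (Suc b) < N (Suc (Suc b))"
      by (rule strict_mono_onD[OF assms(8)]) auto
    with Suc show ?case by simp
  qed simp
  then have unbounded: "\<exists>m\<ge>1. b \<le> N m" for b
    by (metis le_add1 plus_1_eq_Suc)
  show "B_set A N \<subseteq> {0..1}"
    using B_set_subset_unit[of N A, OF N_pos] by auto
  show "contains_AP (B_set A N) n" if "contains_AP (int ` A) n"
    using AP_in_B_set[of N A n, OF N_pos ne unbounded that] by simp
  show "contains_AP (int ` A) n" if "contains_AP (B_set A N) n"
  proof (cases "n \<ge> 2")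
    case True
    then show ?thesis
      using AP_of_AP_in_B_set[of N n A, OF N_pos _ that] by simp
  next
    \<comment> \<open>With at most one term there is nothing to separate; any element of \<open>A\<close> will do.\<close>
    case False
    obtain a where "a \<in> A"
      using ne[of 1] by auto
    then have "int a + of_nat i * 1 \<in> int ` A" if "i < n" for i
    proof -
      have "i = 0"
        using False that by linarith
      with \<open>a \<in> A\<close> show ?thesis
        by simp
    qed
    then show ?thesis
      unfolding contains_AP_def by (intro exI[of _ "int a"] exI[of _ 1]) simp
  qed
qed

end
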